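(* For every $\epsilon>0$ there exists a sequence $\delta_m\to0$ such that: (i) if there exists an $(\alpha,\beta;k,n)$-map with $\beta>\frac12$ and $\alpha\in[\frac12+\epsilon,1-\epsilon]$, then $$ \alpha\ge\beta+\frac{(2\beta-1)^2}{2}\delta_k; $$ (ii) for any positive integers $k,n$, any map $f:\mathbb{F}_2^k\to\mathbb{F}_2^n$, any $\beta>\frac12$ and $\alpha\in[\frac12+\epsilon,1-\epsilon]$, and any set $S\subset\mathbb{F}_2^k$ of size $$ |S|>2^k\,\frac{\frac{2\beta}{2\beta-1}}{\frac{2\alpha}{2\alpha-1}-\delta_k}, $$ there exists a pair $x,x'\in S$ with $|x-x'|>\alpha k$ and $|f(x)-f(x')|\le\beta n$.
   Context: For $z\in\mathbb{F}_2^m$, $|z|$ denotes the Hamming weight. A map $f:\mathbb{F}_2^k\to\mathbb{F}_2^n$ is an $(\alpha,\beta;k,n)$-map if $\alpha k$ and $\beta n$ are integers and for all $x,x'\in\mathbb{F}_2^k$ either $|f(x)-f(x')|>\beta n$ or $|x-x'|\le\alpha k$.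
   Formalization: In (i) the sign of δ_k is reversed: α ≥ β − (2β−1)²/2·δ_k, since the printed signs in (i) and (ii) contradict each other for a common δ; in (ii) the denominator 2α/(2α−1) − δ_k is assumed positive, since otherwise S = ∅ is a counterexample. *)

theory Defs
  imports
    Complex_Main
    "HOL-Library.Z2"
    "HOL-Library.FuncSet"
    "Jordan_Normal_Form.Matrix"
begin

text \<open>
  The space $\mathbb{F}_2^k$ is the set \<^term>\<open>carrier_vec k :: bit vec set\<close>.
\<close>

definition hamming_weight :: "bit vec \<Rightarrow> nat" where
  "hamming_weight z = card {i. i < dim_vec z \<and> z $ i \<noteq> 0}"

definition hamming_map ::
    "real \<Rightarrow> real \<Rightarrow> nat \<Rightarrow> nat \<Rightarrow> (bit vec \<Rightarrow> bit vec) \<Rightarrow> bool" where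
  "hamming_map \<alpha> \<beta> k n f \<longleftrightarrow>
     f \<in> carrier_vec k \<rightarrow> carrier_vec n \<and>
     \<alpha> * real k \<in> \<int> \<and> \<beta> * real n \<in> \<int> \<and>
     (\<forall>x \<in> carrier_vec k. \<forall>x' \<in> carrier_vec k.
        real (hamming_weight (f x - f x')) > \<beta> * real n \<or>
        real (hamming_weight (x - x')) \<le> \<alpha> * real k)"

end

theory Submission
  imports Defs
begin

text \<open>Let the noise with rate \<open>a > 1/2\<close> flip each coordinate of \<open>F\<^sub>2\<^sup>k\<close> independently
  with probability \<open>a\<close>. Its transition kernel has the eigenvalues \<open>(1 - 2 * a) ^ j\<close>, so adding
  \<open>2 * a - 1\<close> times the identity makes it positive semidefinite, with eigenvalue \<open>2 * a\<close> on
  constants. Evaluate this form on the indicator of \<open>S\<close> and on the functions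
  \<open>x \<mapsto> (-1) ^ f(x)\<^sub>i\<close> restricted to \<open>S\<close>, averaged over \<open>i\<close>. If \<open>a\<close> is slightly larger than
  \<open>\<alpha>\<close>, then by Chebyshev nearly all mass of the kernel lies on pairs at distance more than
  \<open>\<alpha> * k\<close>, and if all such pairs of \<open>S\<close> had images at distance more than \<open>\<beta> * n\<close>, the average of
  \<open>(-1) ^ (f(x)\<^sub>i + f(x')\<^sub>i)\<close> over \<open>i\<close> would be less than \<open>-(2 * \<beta> - 1)\<close> on them. Comparing
  the two evaluations, as in the Plotkin bound, limits the size of \<open>S\<close>. The first claim is the
  case \<open>S = F\<^sub>2\<^sup>k\<close>.\<close>

section \<open>Signs and supports of bit vectors\<close>

definition bit_sign :: "bit \<Rightarrow> real" where
  "bit_sign b = (if b = 0 then 1 else -1)"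

lemma bit_sign_squared [simp]: "bit_sign b * bit_sign b = 1"
  by (simp add: bit_sign_def)

lemma bit_sign_diff: "bit_sign (b - c) = bit_sign b * bit_sign c"
  by (cases b; cases c) (simp_all add: bit_sign_def)

text \<open>Identifies F_2^k with the subsets of \<open>{..<k}\<close>, so that sums over noise
  vectors become sums over sets of flipped coordinates.\<close>

definition bit_support :: "bit vec \<Rightarrow> nat set" where
  "bit_support x = {i. i < dim_vec x \<and> x $ i \<noteq> 0}"

lemma hamming_weight_eq_card_support: "hamming_weight x = card (bit_support x)"
  by (simp add: hamming_weight_def bit_support_def)

lemma bit_support_subset: "x \<in> carrier_vec k \<Longrightarrow> bit_support x \<subseteq> {..<k}"
  by (auto simp: bit_support_def)

lemma bij_betw_bit_support: "bij_betw bit_support (carrier_vec k) (Pow {..<k})"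
proof (rule bij_betw_imageI)
  show "inj_on bit_support (carrier_vec k)"
  proof (rule inj_onI)
    fix x y :: "bit vec"
    assume "x \<in> carrier_vec k" "y \<in> carrier_vec k" and eq: "bit_support x = bit_support y"
    then have dims: "dim_vec x = k" "dim_vec y = k" by auto
    have "x $ i = y $ i" if "i < k" for i
    proof -
      have "x $ i \<noteq> 0 \<longleftrightarrow> y $ i \<noteq> 0"
        using eq that dims by (auto simp: bit_support_def)
      then show ?thesis by (cases "x $ i"; cases "y $ i") auto
    qed
    then show "x = y" using dims by (intro eq_vecI) auto
  qed
  show "bit_support ` carrier_vec k = Pow {..<k}"
  proof (intro equalityI subsetI)
    fix X assume "X \<in> bit_support ` carrier_vec k"
    then show "X \<in> Pow {..<k}" using bit_support_subset by blast
  next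
    fix X assume X: "X \<in> Pow {..<k}"
    define x :: "bit vec" where "x = vec k (\<lambda>i. if i \<in> X then 1 else 0)"
    have "bit_support x = X" using X by (auto simp: bit_support_def x_def split: if_splits)
    moreover have "x \<in> carrier_vec k" by (simp add: x_def)
    ultimately show "X \<in> bit_support ` carrier_vec k" by blast
  qed
qed

lemma finite_carrier_bit_vec: "finite (carrier_vec k :: bit vec set)"
  using bij_betw_finite[OF bij_betw_bit_support[of k]] by simp

lemma card_carrier_bit_vec: "card (carrier_vec k :: bit vec set) = 2 ^ k"
  using bij_betw_same_card[OF bij_betw_bit_support[of k]] by (simp add: card_Pow)

text \<open>Needed to rewrite a kernel sum over \<open>y\<close> with \<open>x\<close> fixed as a
  sum of noise masses over distinct flip sets.\<close>

lemma inj_on_bit_support_diff: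
  assumes "x \<in> carrier_vec k"
  shows "inj_on (\<lambda>y. bit_support (x - y)) (carrier_vec k)"
proof (rule inj_onI)
  fix y z :: "bit vec"
  assume yz: "y \<in> carrier_vec k" "z \<in> carrier_vec k"
    and eq: "bit_support (x - y) = bit_support (x - z)"
  have "x - y = x - z"
    using bij_betw_imp_inj_on[OF bij_betw_bit_support] eq
    by (rule inj_onD[where A = "carrier_vec k"]) (use assms yz in auto)
  then have "(x - y) $ i = (x - z) $ i" for i by simp
  then have diff: "x $ i - y $ i = x $ i - z $ i" if "i < k" for i
    using that assms yz by (metis carrier_vecD index_minus_vec(1))
  have "y $ i = z $ i" if "i < k" for i
    using diff[OF that] by (cases "x $ i"; cases "y $ i"; cases "z $ i") auto
  then show "y = z" using yz by (intro eq_vecI) auto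
qed

text \<open>An agreeing coordinate contributes 1 and a differing one -1. This turns distances of
  images into the correlations that the quadratic form evaluates.\<close>

lemma sum_bit_sign:
  assumes "x \<in> carrier_vec n" "y \<in> carrier_vec n"
  shows "(\<Sum>i<n. bit_sign (x $ i) * bit_sign (y $ i)) = real n - 2 * real (hamming_weight (x - y))"
proof -
  have "(\<Sum>i<n. bit_sign (x $ i) * bit_sign (y $ i))
      = (\<Sum>i<n. 1 - 2 * of_bool (i \<in> bit_support (x - y)))"
    using assms by (intro sum.cong) (auto simp: bit_sign_diff[symmetric] bit_support_def bit_sign_def)
  also have "\<dots> = real n - 2 * real (card ({..<n} \<inter> bit_support (x - y)))"
    by (simp add: sum_subtractf sum_distrib_left[symmetric] Int_def)
  also have "{..<n} \<inter> bit_support (x - y) = bit_support (x - y)"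
    using assms bit_support_subset[of "x - y" n] by auto
  finally show ?thesis by (simp add: hamming_weight_eq_card_support)
qed

section \<open>The noise kernel and its spectrum\<close>

text \<open>For \<open>X\<close> inside \<open>{..<k}\<close>, the probability that the noise flips
  exactly the coordinates in \<open>X\<close>.\<close>

definition noise_mass :: "real \<Rightarrow> nat \<Rightarrow> nat set \<Rightarrow> real" where
  "noise_mass a k X = a ^ card X * (1 - a) ^ (k - card X)"

lemma noise_mass_nonneg: "0 \<le> a \<Longrightarrow> a \<le> 1 \<Longrightarrow> 0 \<le> noise_mass a k X"
  by (simp add: noise_mass_def)

text \<open>Each factor is \<open>a\<close> where the vectors differ and \<open>1 - a\<close> where
  they agree. Being affine in the product of signs, the factors multiply out into
  characters.\<close>

lemma noise_mass_eq_prod: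
  assumes "x \<in> carrier_vec k" "y \<in> carrier_vec k"
  shows "noise_mass a k (bit_support (x - y))
    = (\<Prod>i<k. (1 + (1 - 2 * a) * (bit_sign (x $ i) * bit_sign (y $ i))) / 2)"
proof -
  let ?D = "bit_support (x - y)"
  have D: "?D \<subseteq> {..<k}" using assms bit_support_subset[of "x - y" k] by auto
  have "(\<Prod>i<k. (1 + (1 - 2 * a) * (bit_sign (x $ i) * bit_sign (y $ i))) / 2)
      = (\<Prod>i<k. if i \<in> ?D then a else 1 - a)"
    using assms by (intro prod.cong refl)
      (auto simp: bit_sign_diff[symmetric] bit_support_def bit_sign_def field_simps)
  also have "\<dots> = a ^ card ({..<k} \<inter> ?D) * (1 - a) ^ card ({..<k} - ?D)"
    by (simp add: prod.If_cases Diff_eq)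
  also have "{..<k} \<inter> ?D = ?D" using D by auto
  also have "card ({..<k} - ?D) = k - card ?D"
    using D by (simp add: card_Diff_subset finite_subset)
  finally show ?thesis by (simp add: noise_mass_def)
qed

lemma prod_affine_expand:
  fixes s t :: "nat \<Rightarrow> real"
  shows "(\<Prod>i<k. (1 + c * (s i * t i)) / 2)
    = (\<Sum>U\<in>Pow {..<k}. c ^ card U * (prod s U * prod t U)) / 2 ^ k"
proof -
  have "(\<Prod>i<k. (1 + c * (s i * t i)) / 2) = (\<Prod>i<k. c * (s i * t i) + 1) / 2 ^ k"
    by (simp add: prod_dividef add.commute)
  also have "(\<Prod>i<k. c * (s i * t i) + 1) = (\<Sum>U\<in>Pow {..<k}. \<Prod>i\<in>U. c * (s i * t i))"
    by (subst prod_add) auto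
  finally show ?thesis by (simp add: prod.distrib)
qed

text \<open>After expansion, the character of \<open>U\<close> splits into a factor in
  \<open>x\<close> and the same factor in \<open>y\<close>, so each double sum is a square.\<close>

lemma sum_sum_prod_affine:
  fixes s :: "'a \<Rightarrow> nat \<Rightarrow> real" and g :: "'a \<Rightarrow> real"
  shows "(\<Sum>x\<in>S. \<Sum>y\<in>S. g x * g y * (\<Prod>i<k. (1 + c * (s x i * s y i)) / 2))
    = (\<Sum>U\<in>Pow {..<k}. c ^ card U * (\<Sum>x\<in>S. g x * prod (s x) U)\<^sup>2) / 2 ^ k"
proof -
  have "(\<Sum>x\<in>S. \<Sum>y\<in>S. g x * g y * (\<Prod>i<k. (1 + c * (s x i * s y i)) / 2))
      = (\<Sum>x\<in>S. \<Sum>y\<in>S. \<Sum>U\<in>Pow {..<k}.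
          c ^ card U * ((g x * prod (s x) U) * (g y * prod (s y) U))) / 2 ^ k"
    by (simp add: prod_affine_expand sum_divide_distrib sum_distrib_left mult_ac)
  also have "(\<Sum>x\<in>S. \<Sum>y\<in>S. \<Sum>U\<in>Pow {..<k}.
          c ^ card U * ((g x * prod (s x) U) * (g y * prod (s y) U)))
      = (\<Sum>U\<in>Pow {..<k}. \<Sum>x\<in>S. \<Sum>y\<in>S.
          c ^ card U * ((g x * prod (s x) U) * (g y * prod (s y) U)))"
    by (simp add: sum.swap[of _ "Pow {..<k}" S])
  also have "\<dots> = (\<Sum>U\<in>Pow {..<k}. c ^ card U * (\<Sum>x\<in>S. g x * prod (s x) U)\<^sup>2)"
    by (simp only: power2_eq_square sum_product) (simp add: sum_distrib_left)
  finally show ?thesis .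
qed

text \<open>The characters diagonalise the kernel: the one of a set \<open>U\<close> has eigenvalue
  \<open>(1 - 2 * a) ^ card U \<ge> - (2 * a - 1)\<close>, and the trivial one is responsible for the right-hand side.\<close>

lemma noise_quadratic_form_ge:
  fixes g :: "bit vec \<Rightarrow> real"
  assumes S: "S \<subseteq> carrier_vec k" and a: "1/2 \<le> a" "a \<le> 1"
  shows "2 * a * (\<Sum>x\<in>S. g x)\<^sup>2 / 2 ^ k
    \<le> (\<Sum>x\<in>S. \<Sum>y\<in>S. g x * g y * noise_mass a k (bit_support (x - y)))
      + (2 * a - 1) * (\<Sum>x\<in>S. (g x)\<^sup>2)"
proof -
  let ?h = "\<lambda>U. (\<Sum>x\<in>S. g x * (\<Prod>i\<in>U. bit_sign (x $ i)))\<^sup>2"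
  have fin: "finite S" using S finite_carrier_bit_vec by (rule finite_subset)
  \<comment> \<open>The rate is left general because the expansion is used both at \<open>a\<close>
    and at 0.\<close>
  have form: "(\<Sum>x\<in>S. \<Sum>y\<in>S. g x * g y * noise_mass b k (bit_support (x - y)))
      = (\<Sum>U\<in>Pow {..<k}. (1 - 2 * b) ^ card U * ?h U) / 2 ^ k" for b
  proof -
    have "(\<Sum>x\<in>S. \<Sum>y\<in>S. g x * g y * noise_mass b k (bit_support (x - y)))
      = (\<Sum>x\<in>S. \<Sum>y\<in>S. g x * g y *
           (\<Prod>i<k. (1 + (1 - 2 * b) * (bit_sign (x $ i) * bit_sign (y $ i))) / 2))"
      using S by (intro sum.cong refl) (auto simp: noise_mass_eq_prod subset_iff)
    also have "\<dots> = (\<Sum>U\<in>Pow {..<k}. (1 - 2 * b) ^ card U * ?h U) / 2 ^ k"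
      by (rule sum_sum_prod_affine)
    finally show ?thesis .
  qed
  \<comment> \<open>At rate 0 the kernel is the identity, and the expansion becomes Parseval's
    identity.\<close>
  have diag: "(\<Sum>x\<in>S. (g x)\<^sup>2) = (\<Sum>U\<in>Pow {..<k}. ?h U) / 2 ^ k"
  proof -
    have "noise_mass 0 k (bit_support (x - y)) = (if x = y then 1 else 0)"
      if "x \<in> S" "y \<in> S" for x y
    proof -
      have xy: "x \<in> carrier_vec k" "y \<in> carrier_vec k" using that S by auto
      then have self: "bit_support (x - x) = {}" by (auto simp: bit_support_def)
      have "finite (bit_support (x - y))" by (simp add: bit_support_def)
      moreover have "bit_support (x - y) = {} \<longleftrightarrow> x = y"
        using inj_onD[OF inj_on_bit_support_diff[OF xy(1)], of y x] xy self by auto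
      ultimately show ?thesis using self by (auto simp: noise_mass_def card_gt_0_iff)
    qed
    then have "(\<Sum>x\<in>S. \<Sum>y\<in>S. g x * g y * noise_mass 0 k (bit_support (x - y)))
        = (\<Sum>x\<in>S. \<Sum>y\<in>S. if x = y then (g x)\<^sup>2 else 0)"
      by (intro sum.cong refl) (auto simp: power2_eq_square)
    also have "\<dots> = (\<Sum>x\<in>S. (g x)\<^sup>2)" using fin by simp
    finally show ?thesis using form[of 0] by simp
  qed
  have eigenvalue: "0 \<le> (1 - 2 * a) ^ j + (2 * a - 1)" for j
  proof (cases j)
    case (Suc i)
    have "\<bar>(1 - 2 * a) ^ i\<bar> \<le> 1" using a by (simp add: power_abs power_le_one)
    then have "(2 * a - 1) * (1 - 2 * a) ^ i \<le> (2 * a - 1) * 1"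
      using a by (intro mult_left_mono) auto
    then show ?thesis using Suc by (simp add: algebra_simps)
  qed (use a in simp)
  \<comment> \<open>Only the trivial character is kept: its eigenvalue after the shift is
    \<open>1 + (2 * a - 1)\<close>, and all other terms are nonnegative.\<close>
  have "2 * a * (\<Sum>x\<in>S. g x)\<^sup>2 = (\<Sum>U\<in>{{}}. ((1 - 2 * a) ^ card U + (2 * a - 1)) * ?h U)"
    by simp
  also have "\<dots> \<le> (\<Sum>U\<in>Pow {..<k}. ((1 - 2 * a) ^ card U + (2 * a - 1)) * ?h U)"
    using eigenvalue by (intro sum_mono2) auto
  also have "\<dots> = (\<Sum>U\<in>Pow {..<k}. (1 - 2 * a) ^ card U * ?h U) + (2 * a - 1) * (\<Sum>U\<in>Pow {..<k}. ?h U)"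
    by (simp add: distrib_right sum.distrib sum_distrib_left)
  finally show ?thesis
    unfolding form[of a] diag by (simp add: divide_right_mono add_divide_distrib[symmetric])
qed

section \<open>Moments and lower tail of the noise weight\<close>

text \<open>Conditions on whether coordinate \<open>k\<close> is flipped. The arbitrary weight
  \<open>h\<close> lets one recursion yield the total mass, the mean and the second moment.\<close>

lemma sum_noise_mass_Suc:
  "(\<Sum>X\<in>Pow {..<Suc k}. noise_mass a (Suc k) X * h (card X))
    = (1 - a) * (\<Sum>X\<in>Pow {..<k}. noise_mass a k X * h (card X))
      + a * (\<Sum>X\<in>Pow {..<k}. noise_mass a k X * h (Suc (card X)))"
proof -
  have card: "finite X" "card X \<le> k" "card (insert k X) = Suc (card X)" if "X \<in> Pow {..<k}" for X
    using that card_mono[of "{..<k}" X] by (auto simp: finite_subset intro!: card_insert_disjoint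
        intro: finite_subset[of X "{..<k}"])
  have inj: "inj_on (insert k) (Pow {..<k})"
    by (rule inj_on_inverseI[where g = "\<lambda>X. X - {k}"]) auto
  have "(\<Sum>X\<in>Pow {..<Suc k}. noise_mass a (Suc k) X * h (card X))
    = (\<Sum>X\<in>Pow {..<k}. noise_mass a (Suc k) X * h (card X))
      + (\<Sum>X\<in>insert k ` Pow {..<k}. noise_mass a (Suc k) X * h (card X))"
    unfolding lessThan_Suc Pow_insert by (rule sum.union_disjoint) auto
  also have "(\<Sum>X\<in>insert k ` Pow {..<k}. noise_mass a (Suc k) X * h (card X))
    = a * (\<Sum>X\<in>Pow {..<k}. noise_mass a k X * h (Suc (card X)))"
    unfolding sum_distrib_left
    by (subst sum.reindex[OF inj]) (auto simp: card noise_mass_def intro!: sum.cong)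
  also have "(\<Sum>X\<in>Pow {..<k}. noise_mass a (Suc k) X * h (card X))
    = (1 - a) * (\<Sum>X\<in>Pow {..<k}. noise_mass a k X * h (card X))"
    unfolding sum_distrib_left
    by (rule sum.cong) (auto simp: card noise_mass_def Suc_diff_le)
  finally show ?thesis .
qed

lemma sum_noise_mass: "(\<Sum>X\<in>Pow {..<k}. noise_mass a k X) = 1"
proof (induction k)
  case (Suc k)
  then show ?case using sum_noise_mass_Suc[of a k "\<lambda>_. 1"] by simp
qed (simp add: noise_mass_def)

lemma sum_noise_mass_mean: "(\<Sum>X\<in>Pow {..<k}. noise_mass a k X * real (card X)) = a * real k"
proof (induction k)
  case (Suc k)
  then show ?case using sum_noise_mass_Suc[of a k real] sum_noise_mass[of a k]
    by (simp add: algebra_simps sum.distrib)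
qed simp

lemma sum_noise_mass_second_moment:
  "(\<Sum>X\<in>Pow {..<k}. noise_mass a k X * (real (card X))\<^sup>2) = a * (1 - a) * real k + (a * real k)\<^sup>2"
proof (induction k)
  case (Suc k)
  have "(\<Sum>X\<in>Pow {..<k}. noise_mass a k X * (real (Suc (card X)))\<^sup>2)
    = (\<Sum>X\<in>Pow {..<k}. noise_mass a k X * (real (card X))\<^sup>2)
      + 2 * (\<Sum>X\<in>Pow {..<k}. noise_mass a k X * real (card X)) + (\<Sum>X\<in>Pow {..<k}. noise_mass a k X)"
    unfolding sum_distrib_left sum.distrib[symmetric]
    by (intro sum.cong refl) (simp add: algebra_simps power2_eq_square)
  then show ?case using Suc sum_noise_mass_Suc[of a k "\<lambda>j. (real j)\<^sup>2"]
    by (simp add: sum_noise_mass sum_noise_mass_mean) (simp add: algebra_simps power2_eq_square)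
qed simp

lemma sum_noise_mass_variance:
  "(\<Sum>X\<in>Pow {..<k}. noise_mass a k X * (real (card X) - a * real k)\<^sup>2) = a * (1 - a) * real k"
proof -
  have "(\<Sum>X\<in>Pow {..<k}. noise_mass a k X * (real (card X) - a * real k)\<^sup>2)
    = (\<Sum>X\<in>Pow {..<k}. noise_mass a k X * (real (card X))\<^sup>2)
      - 2 * (a * real k) * (\<Sum>X\<in>Pow {..<k}. noise_mass a k X * real (card X))
      + (a * real k)\<^sup>2 * (\<Sum>X\<in>Pow {..<k}. noise_mass a k X)"
    unfolding sum_distrib_left sum.distrib[symmetric] sum_subtractf[symmetric]
    by (intro sum.cong refl) (simp add: algebra_simps power2_eq_square)
  then show ?thesis
    by (simp add: sum_noise_mass sum_noise_mass_mean sum_noise_mass_second_moment)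
      (simp add: power2_eq_square)
qed

text \<open>Chebyshev's inequality, with the variance bounded through
  \<open>a * (1 - a) \<le> 1/4\<close>.\<close>

lemma noise_mass_lower_tail:
  assumes k: "k > 0" and t: "t > 0" and a: "0 \<le> a" "a \<le> 1"
  shows "(\<Sum>X | X \<subseteq> {..<k} \<and> real (card X) \<le> (a - t) * real k. noise_mass a k X)
    \<le> 1 / (4 * real k * t\<^sup>2)"
proof -
  let ?L = "{X. X \<subseteq> {..<k} \<and> real (card X) \<le> (a - t) * real k}"
  have "(\<Sum>X\<in>?L. noise_mass a k X) * (t * real k)\<^sup>2
      \<le> (\<Sum>X\<in>?L. noise_mass a k X * (real (card X) - a * real k)\<^sup>2)"
    unfolding sum_distrib_right
  proof (intro sum_mono mult_left_mono noise_mass_nonneg a)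
    fix X assume "X \<in> ?L"
    then have "t * real k \<le> a * real k - real (card X)" by (simp add: algebra_simps)
    then have "(t * real k)\<^sup>2 \<le> (a * real k - real (card X))\<^sup>2"
      using t by (intro power_mono) auto
    then show "(t * real k)\<^sup>2 \<le> (real (card X) - a * real k)\<^sup>2"
      by (simp add: power2_commute)
  qed
  also have "\<dots> \<le> (\<Sum>X\<in>Pow {..<k}. noise_mass a k X * (real (card X) - a * real k)\<^sup>2)"
    using a by (intro sum_mono2) (auto intro!: mult_nonneg_nonneg noise_mass_nonneg)
  also have "\<dots> = a * (1 - a) * real k" by (rule sum_noise_mass_variance)
  also have "\<dots> \<le> 1/4 * real k"
    using zero_le_power2[of "a - 1/2"]
    by (intro mult_right_mono) (auto simp: power2_eq_square algebra_simps)
  finally show ?thesis using k t by (simp add: field_simps power2_eq_square)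
qed

section \<open>Size of separated sets for a fixed shift of the noise rate\<close>

text \<open>The form at the constant 1 forces much kernel mass on pairs from \<open>S\<close>; its
  positivity at the coordinate signs of \<open>f\<close> limits the mass \<open>Q\<close> of far
  pairs, whose images are negatively correlated. The mass \<open>P\<close> of near pairs is a lower
  tail.\<close>

lemma separated_set_bound:
  fixes \<alpha> \<beta> t :: real
  assumes S: "S \<subseteq> carrier_vec k" and f: "f \<in> carrier_vec k \<rightarrow> carrier_vec n"
    and k: "k > 0" and n: "n > 0" and t: "t > 0" and \<alpha>: "1/2 \<le> \<alpha>" "\<alpha> + t \<le> 1" and \<beta>: "\<beta> > 1/2"
    and sep: "\<And>x y. x \<in> S \<Longrightarrow> y \<in> S \<Longrightarrow> real (hamming_weight (x - y)) > \<alpha> * real k \<Longrightarrow>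
      real (hamming_weight (f x - f y)) > \<beta> * real n"
  shows "2 * (\<alpha> + t) * (2 * \<beta> - 1) * real (card S)
    \<le> 2 ^ k * (2 * \<beta>) * (2 * (\<alpha> + t) - 1 + 1 / (4 * real k * t\<^sup>2))"
proof -
  define a where "a = \<alpha> + t"
  define \<eta> where "\<eta> = 1 / (4 * real k * t\<^sup>2)"
  define p where "p x y = noise_mass a k (bit_support (x - y))" for x y
  define near where "near x y \<longleftrightarrow> real (hamming_weight (x - y)) \<le> \<alpha> * real k" for x y
  define r where "r x y = (\<Sum>i<n. bit_sign (f x $ i) * bit_sign (f y $ i)) / real n" for x y
  define N where "N = real (card S)"
  define P where "P = (\<Sum>x\<in>S. \<Sum>y\<in>S. if near x y then p x y else 0)"
  define Q where "Q = (\<Sum>x\<in>S. \<Sum>y\<in>S. if near x y then 0 else p x y)"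
  have a: "1/2 \<le> a" "a \<le> 1" using \<alpha> t by (auto simp: a_def)
  have fin: "finite S" using S finite_carrier_bit_vec by (rule finite_subset)
  have p_nonneg: "0 \<le> p x y" for x y using a by (simp add: p_def noise_mass_nonneg)

  \<comment> \<open>For fixed \<open>x\<close>, near points give distinct flip sets of size at most
    \<open>\<alpha> * k = (a - t) * k\<close>, so the tail bound applies.\<close>
  have "(\<Sum>y\<in>S. if near x y then p x y else 0) \<le> \<eta>" if "x \<in> S" for x
  proof -
    have x: "x \<in> carrier_vec k" using that S by auto
    let ?T = "{y \<in> S. near x y}"
    have "(\<Sum>y\<in>S. if near x y then p x y else 0) = (\<Sum>y\<in>?T. p x y)"
      using fin by (simp add: sum.If_cases Int_def)
    also have "\<dots> = (\<Sum>X\<in>(\<lambda>y. bit_support (x - y)) ` ?T. noise_mass a k X)"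
      by (subst sum.reindex)
        (use inj_on_bit_support_diff[OF x] S in \<open>auto simp: p_def intro: inj_on_subset\<close>)
    also have "\<dots> \<le> (\<Sum>X | X \<subseteq> {..<k} \<and> real (card X) \<le> (a - t) * real k. noise_mass a k X)"
    proof (rule sum_mono2)
      show "(\<lambda>y. bit_support (x - y)) ` ?T \<subseteq> {X. X \<subseteq> {..<k} \<and> real (card X) \<le> (a - t) * real k}"
      proof
        fix X assume "X \<in> (\<lambda>y. bit_support (x - y)) ` ?T"
        then obtain y where y: "y \<in> S" "near x y" "X = bit_support (x - y)" by auto
        then have "x - y \<in> carrier_vec k" using x S by auto
        then show "X \<in> {X. X \<subseteq> {..<k} \<and> real (card X) \<le> (a - t) * real k}"
          using y bit_support_subset
          by (auto simp: near_def a_def hamming_weight_eq_card_support)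
      qed
      show "finite {X. X \<subseteq> {..<k} \<and> real (card X) \<le> (a - t) * real k}"
        by (rule finite_subset[of _ "Pow {..<k}"]) auto
    qed (use a in \<open>simp add: noise_mass_nonneg\<close>)
    also have "\<dots> \<le> \<eta>"
      unfolding \<eta>_def using k t a by (intro noise_mass_lower_tail) auto
    finally show ?thesis .
  qed
  then have P: "P \<le> \<eta> * N"
    unfolding P_def N_def by (subst mult.commute) (rule sum_bounded_above)

  have total: "P + Q = (\<Sum>x\<in>S. \<Sum>y\<in>S. p x y)"
    unfolding P_def Q_def sum.distrib[symmetric] by (intro sum.cong refl) auto
  have one: "2 * a * N\<^sup>2 / 2 ^ k \<le> P + Q + (2 * a - 1) * N"
    using noise_quadratic_form_ge[OF S a, of "\<lambda>_. 1"] total by (simp add: N_def p_def)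

  \<comment> \<open>The form is applied to the sign of each coordinate of \<open>f\<close>. Signs
    square to 1, so the diagonal term is \<open>(2 * a - 1) * N\<close>.\<close>
  have "0 \<le> (\<Sum>i<n. (\<Sum>x\<in>S. \<Sum>y\<in>S. bit_sign (f x $ i) * bit_sign (f y $ i) * p x y) + (2 * a - 1) * N)"
  proof (rule sum_nonneg)
    fix i
    have "0 \<le> 2 * a * (\<Sum>x\<in>S. bit_sign (f x $ i))\<^sup>2 / 2 ^ k" using a by simp
    then show "0 \<le> (\<Sum>x\<in>S. \<Sum>y\<in>S. bit_sign (f x $ i) * bit_sign (f y $ i) * p x y) + (2 * a - 1) * N"
      using noise_quadratic_form_ge[OF S a, of "\<lambda>x. bit_sign (f x $ i)"]
      by (simp add: p_def N_def power2_eq_square)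
  qed
  also have "\<dots> = (\<Sum>x\<in>S. \<Sum>y\<in>S. \<Sum>i<n. bit_sign (f x $ i) * bit_sign (f y $ i) * p x y)
      + real n * ((2 * a - 1) * N)"
    by (simp add: sum.distrib sum.swap[of _ "{..<n}" S])
  also have "\<dots> = real n * ((\<Sum>x\<in>S. \<Sum>y\<in>S. r x y * p x y) + (2 * a - 1) * N)"
  proof -
    have "(\<Sum>i<n. bit_sign (f x $ i) * bit_sign (f y $ i) * p x y) = real n * (r x y * p x y)" for x y
      using n by (simp add: r_def sum_distrib_right)
    then show ?thesis by (simp add: sum_distrib_left distrib_left)
  qed
  finally have two: "0 \<le> (\<Sum>x\<in>S. \<Sum>y\<in>S. r x y * p x y) + (2 * a - 1) * N"
    using n by (simp add: zero_le_mult_iff)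

  \<comment> \<open>Near pairs use the trivial bound \<open>r x y \<le> 1\<close>; far pairs have
    \<open>r x y \<le> - (2 * \<beta> - 1)\<close> by separation.\<close>
  have "(\<Sum>x\<in>S. \<Sum>y\<in>S. r x y * p x y)
      \<le> (\<Sum>x\<in>S. \<Sum>y\<in>S. (if near x y then p x y else 0) - (2 * \<beta> - 1) * (if near x y then 0 else p x y))"
  proof (intro sum_mono)
    fix x y assume xy: "x \<in> S" "y \<in> S"
    then have "f x \<in> carrier_vec n" "f y \<in> carrier_vec n" using S f by auto
    then have r: "r x y = 1 - 2 * (real (hamming_weight (f x - f y)) / real n)"
      using n by (simp add: r_def sum_bit_sign diff_divide_distrib)
    show "r x y * p x y
        \<le> (if near x y then p x y else 0) - (2 * \<beta> - 1) * (if near x y then 0 else p x y)"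
    proof (cases "near x y")
      case True
      have "r x y \<le> 1" using r by simp
      then have "r x y * p x y \<le> 1 * p x y" using p_nonneg by (intro mult_right_mono)
      then show ?thesis using True by simp
    next
      case False
      then have "\<beta> * real n < real (hamming_weight (f x - f y))"
        using sep[OF xy] by (simp add: near_def)
      then have "\<beta> \<le> real (hamming_weight (f x - f y)) / real n" using n by (simp add: pos_le_divide_eq)
      then have "r x y \<le> - (2 * \<beta> - 1)" using r by simp
      then have "r x y * p x y \<le> - (2 * \<beta> - 1) * p x y" using p_nonneg by (intro mult_right_mono)
      then show ?thesis using False by (simp add: algebra_simps)
    qed
  qed
  also have "\<dots> = P - (2 * \<beta> - 1) * Q"
    by (simp only: P_def Q_def sum_subtractf sum_distrib_left)
  finally have three: "(2 * \<beta> - 1) * Q \<le> P + (2 * a - 1) * N" using two by simp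

  \<comment> \<open>Scaling \<open>one\<close> by \<open>2 * \<beta> - 1\<close> allows
    \<open>three\<close> to eliminate \<open>Q\<close>; the coefficients of \<open>P\<close> and of
    \<open>(2 * a - 1) * N\<close> then add up to \<open>2 * \<beta>\<close>.\<close>
  have "(2 * \<beta> - 1) * (2 * a * N\<^sup>2 / 2 ^ k) \<le> (2 * \<beta> - 1) * (P + Q + (2 * a - 1) * N)"
    using one \<beta> by (intro mult_left_mono) auto
  also have "\<dots> \<le> 2 * \<beta> * (P + (2 * a - 1) * N)"
    using three by (simp add: algebra_simps)
  also have "\<dots> \<le> 2 * \<beta> * (\<eta> * N + (2 * a - 1) * N)"
    using P \<beta> by (intro mult_left_mono) auto
  finally have main: "N * (2 * a * (2 * \<beta> - 1) * N) \<le> N * (2 ^ k * (2 * \<beta>) * (2 * a - 1 + \<eta>))"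
    by (simp add: field_simps power2_eq_square)
  \<comment> \<open>A factor \<open>N\<close> is cancelled, so empty \<open>S\<close> is treated
    separately.\<close>
  have "2 * a * (2 * \<beta> - 1) * N \<le> 2 ^ k * (2 * \<beta>) * (2 * a - 1 + \<eta>)"
  proof (cases "card S = 0")
    case True
    then show ?thesis using a \<beta> by (simp add: N_def \<eta>_def)
  next
    case False
    then show ?thesis using main by (simp add: N_def)
  qed
  then show ?thesis by (simp add: a_def \<eta>_def N_def)
qed

section \<open>Choice of the shift and the error sequence\<close>

text \<open>Shifting the rate by \<open>t\<close> and adding a tail of \<open>t / 4\<close> costs
  only O(t): with \<open>u = 2 * \<alpha> - 1\<close> and \<open>D = u + 9 * t / 4\<close>, the
  difference of the ratios has a numerator of order \<open>t\<close> over \<open>u * D\<close>,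
  where both factors are at least \<open>2 * \<epsilon>\<close>.\<close>

lemma noise_rate_ge:
  fixes \<alpha> t \<epsilon> :: real
  assumes \<epsilon>: "\<epsilon> > 0" and t: "t > 0" and \<alpha>: "1/2 + \<epsilon> \<le> \<alpha>" "\<alpha> \<le> 1"
  shows "2 * \<alpha> / (2 * \<alpha> - 1) - 5 * t / (8 * \<epsilon>\<^sup>2) \<le> 2 * (\<alpha> + t) / (2 * (\<alpha> + t) - 1 + t / 4)"
proof -
  define u where "u = 2 * \<alpha> - 1"
  define D where "D = u + 9 * t / 4"
  have u: "2 * \<epsilon> \<le> u" "u \<le> 1" using \<alpha> by (auto simp: u_def)
  have D: "2 * \<epsilon> \<le> D" using u t by (simp add: D_def)
  have pos: "u > 0" "D > 0" using u D \<epsilon> by linarith+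
  have "2 * \<alpha> / (2 * \<alpha> - 1) - 2 * (\<alpha> + t) / (2 * (\<alpha> + t) - 1 + t / 4) = (u + 1) / u - (u + 1 + 2 * t) / D"
    by (simp add: u_def D_def algebra_simps)
  also have "\<dots> = (9 * t / 4 + u * t / 4) / (u * D)"
    using pos by (simp add: divide_simps) (simp add: D_def algebra_simps)
  also have "\<dots> \<le> (5 * t / 2) / (2 * \<epsilon> * (2 * \<epsilon>))"
  proof (rule frac_le)
    have "u * t \<le> 1 * t" using u t by (intro mult_right_mono) auto
    then show "9 * t / 4 + u * t / 4 \<le> 5 * t / 2" by linarith
    show "2 * \<epsilon> * (2 * \<epsilon>) \<le> u * D" using u D \<epsilon> pos by (intro mult_mono) auto
  qed (use \<epsilon> t in auto)
  also have "\<dots> = 5 * t / (8 * \<epsilon>\<^sup>2)" by (simp add: power2_eq_square)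
  finally show ?thesis by simp
qed

text \<open>The shift \<open>k powr (-1/3)\<close> of the noise rate makes the Chebyshev tail \<open>1 / (4 * k * t\<^sup>2)\<close>
  equal to \<open>t / 4\<close>. The first branch is large enough to make both claims trivial.\<close>

definition rate_loss :: "real \<Rightarrow> nat \<Rightarrow> real" where
  "rate_loss \<epsilon> k = (if k = 0 \<or> real k powr (-1/3) > \<epsilon> then 1 + 1 / (2 * \<epsilon>)
     else 5 * real k powr (-1/3) / (8 * \<epsilon>\<^sup>2))"

lemma rate_loss_nonneg: "\<epsilon> > 0 \<Longrightarrow> 0 \<le> rate_loss \<epsilon> k"
  by (simp add: rate_loss_def)

lemma rate_loss_tendsto_0:
  assumes "\<epsilon> > 0"
  shows "rate_loss \<epsilon> \<longlonglongrightarrow> 0"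
proof -
  have lim: "(\<lambda>k. real k powr (-1/3)) \<longlonglongrightarrow> 0"
    by (rule tendsto_neg_powr) (auto intro: filterlim_real_sequentially)
  then have "eventually (\<lambda>k. real k powr (-1/3) < \<epsilon>) sequentially"
    using assms by (rule order_tendstoD)
  then have ev: "eventually (\<lambda>k. 5 * real k powr (-1/3) / (8 * \<epsilon>\<^sup>2) = rate_loss \<epsilon> k) sequentially"
    using eventually_gt_at_top[of 0] by eventually_elim (simp add: rate_loss_def)
  have "(\<lambda>k. 5 * real k powr (-1/3) / (8 * \<epsilon>\<^sup>2)) \<longlonglongrightarrow> 5 * 0 / (8 * \<epsilon>\<^sup>2)"
    using assms by (intro tendsto_intros lim) auto
  then show ?thesis using ev by (simp add: Lim_transform_eventually)
qed

text \<open>Kept in product form, since the coefficient of \<open>card S\<close> may be nonpositive,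
  which is the case in the first branch of \<open>rate_loss\<close>.\<close>

lemma separated_set_rate_bound:
  fixes \<epsilon> \<alpha> \<beta> :: real
  assumes \<epsilon>: "\<epsilon> > 0" and S: "S \<subseteq> carrier_vec k" and f: "f \<in> carrier_vec k \<rightarrow> carrier_vec n"
    and n: "n > 0" and \<alpha>: "\<alpha> \<in> {1/2 + \<epsilon>..1 - \<epsilon>}" and \<beta>: "\<beta> > 1/2"
    and sep: "\<And>x y. x \<in> S \<Longrightarrow> y \<in> S \<Longrightarrow> real (hamming_weight (x - y)) > \<alpha> * real k \<Longrightarrow>
      real (hamming_weight (f x - f y)) > \<beta> * real n"
  shows "(2 * \<alpha> / (2 * \<alpha> - 1) - rate_loss \<epsilon> k) * (2 * \<beta> - 1) * real (card S) \<le> 2 ^ k * (2 * \<beta>)"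
proof (cases "k = 0 \<or> real k powr (-1/3) > \<epsilon>")
  case True
  have "2 * \<alpha> / (2 * \<alpha> - 1) = 1 + 1 / (2 * \<alpha> - 1)" using \<alpha> \<epsilon> by (auto simp: divide_simps)
  also have "\<dots> \<le> 1 + 1 / (2 * \<epsilon>)" using \<alpha> \<epsilon> by (auto intro!: frac_le)
  finally have "2 * \<alpha> / (2 * \<alpha> - 1) - rate_loss \<epsilon> k \<le> 0" using True by (simp add: rate_loss_def)
  then have "(2 * \<alpha> / (2 * \<alpha> - 1) - rate_loss \<epsilon> k) * ((2 * \<beta> - 1) * real (card S)) \<le> 0"
    using \<beta> by (intro mult_nonpos_nonneg) auto
  also have "0 \<le> 2 ^ k * (2 * \<beta>)" using \<beta> by simp
  finally show ?thesis by (simp add: mult.assoc)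
next
  case False
  define t where "t = real k powr (-1/3)"
  \<comment> \<open>From \<open>t \<le> \<epsilon>\<close> and
    \<open>\<alpha> \<le> 1 - \<epsilon>\<close> it follows that \<open>\<alpha> + t\<close> is
    still a probability.\<close>
  have k: "k > 0" and t: "t > 0" "t \<le> \<epsilon>" using False by (auto simp: t_def)
  have "real k * t ^ 3 = real k powr 1 * real k powr (-1)"
    using k by (simp add: t_def powr_power)
  also have "\<dots> = 1" using k by (simp add: powr_add[symmetric])
  finally have "real k * t ^ 3 = 1" .
  then have tail: "1 / (4 * real k * t\<^sup>2) = t / 4"
    using k t by (simp add: field_simps power2_eq_square power3_eq_cube)
  define D where "D = 2 * (\<alpha> + t) - 1 + t / 4"
  have D: "D > 0" using \<alpha> \<epsilon> t by (simp add: D_def)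
  have "(2 * \<alpha> / (2 * \<alpha> - 1) - rate_loss \<epsilon> k) * ((2 * \<beta> - 1) * real (card S))
      \<le> 2 * (\<alpha> + t) / D * ((2 * \<beta> - 1) * real (card S))"
    using noise_rate_ge[OF \<epsilon> t(1), of \<alpha>] \<alpha> \<beta> \<epsilon> False
    by (intro mult_right_mono) (auto simp: rate_loss_def D_def t_def)
  also have "\<dots> = 2 * (\<alpha> + t) * (2 * \<beta> - 1) * real (card S) / D" by simp
  also have "\<dots> \<le> 2 ^ k * (2 * \<beta>) * D / D"
    using separated_set_bound[OF S f k n t(1), of \<alpha> \<beta>] \<alpha> \<beta> \<epsilon> t sep tail D
    by (intro divide_right_mono) (auto simp: D_def)
  also have "\<dots> = 2 ^ k * (2 * \<beta>)" using D by simp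
  finally show ?thesis by (simp add: mult.assoc)
qed

section \<open>The two claims\<close>

text \<open>If \<open>n = 0\<close>, all images are at distance \<open>0 = \<beta> * n\<close>,
  while the all-ones and zero vectors are at distance \<open>k > \<alpha> * k\<close>.\<close>

lemma hamming_map_codomain_pos:
  assumes "hamming_map \<alpha> \<beta> k n f" "k > 0" "\<alpha> < 1"
  shows "n > 0"
proof (rule ccontr)
  assume "\<not> n > 0"
  then have n: "n = 0" by simp
  define x y :: "bit vec" where "x = vec k (\<lambda>_. 1)" and "y = vec k (\<lambda>_. 0)"
  have xy: "x \<in> carrier_vec k" "y \<in> carrier_vec k" by (auto simp: x_def y_def)
  have "{i. i < dim_vec (x - y) \<and> (x - y) $ i \<noteq> 0} = {..<k}" by (auto simp: x_def y_def)
  then have "hamming_weight (x - y) = k" by (simp add: hamming_weight_def)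
  moreover have "hamming_weight (f x - f y) = 0"
    using assms(1) xy n by (auto simp: hamming_map_def hamming_weight_def Pi_iff)
  ultimately have "real k \<le> \<alpha> * real k"
    using assms(1) xy n by (force simp: hamming_map_def)
  then show False using assms(2,3) by simp
qed

text \<open>The sequence is a nonnegative loss, hence subtracted in both claims. The second claim
  asks for a positive denominator: otherwise an empty or one-point \<open>S\<close> could meet the
  size condition.\<close>

theorem theorem3:
  fixes \<epsilon> :: real
  assumes "\<epsilon> > 0"
  shows "\<exists>\<delta> :: nat \<Rightarrow> real. \<delta> \<longlonglongrightarrow> 0 \<and>
    (\<forall>\<alpha> \<beta> k n.
       (\<exists>f. hamming_map \<alpha> \<beta> k n f) \<longrightarrow> \<beta> > 1/2 \<longrightarrow> \<alpha> \<in> {1/2 + \<epsilon>..1 - \<epsilon>} \<longrightarrow>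
       \<alpha> \<ge> \<beta> - (2 * \<beta> - 1)\<^sup>2 / 2 * \<delta> k) \<and>
    (\<forall>k n f \<alpha> \<beta> S.
       k > 0 \<longrightarrow> n > 0 \<longrightarrow> f \<in> carrier_vec k \<rightarrow> carrier_vec n \<longrightarrow>
       \<beta> > 1/2 \<longrightarrow> \<alpha> \<in> {1/2 + \<epsilon>..1 - \<epsilon>} \<longrightarrow> S \<subseteq> carrier_vec k \<longrightarrow>
       2 * \<alpha> / (2 * \<alpha> - 1) - \<delta> k > 0 \<longrightarrow>
       real (card S) > 2 ^ k * ((2 * \<beta> / (2 * \<beta> - 1)) / (2 * \<alpha> / (2 * \<alpha> - 1) - \<delta> k)) \<longrightarrow>
       (\<exists>x \<in> S. \<exists>x' \<in> S. real (hamming_weight (x - x')) > \<alpha> * real k \<and>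
                        real (hamming_weight (f x - f x')) \<le> \<beta> * real n))"
proof (intro exI[of _ "rate_loss \<epsilon>"] conjI allI impI)
  show "rate_loss \<epsilon> \<longlonglongrightarrow> 0" using assms by (rule rate_loss_tendsto_0)
next
  fix \<alpha> \<beta> :: real and k n :: nat
  assume "\<exists>f. hamming_map \<alpha> \<beta> k n f" and \<beta>: "\<beta> > 1/2" and \<alpha>: "\<alpha> \<in> {1/2 + \<epsilon>..1 - \<epsilon>}"
  then obtain f where f: "hamming_map \<alpha> \<beta> k n f" by blast
  let ?\<delta> = "rate_loss \<epsilon> k"
  have \<delta>: "?\<delta> \<ge> 0" using assms by (rule rate_loss_nonneg)
  have "2 * \<alpha> / (2 * \<alpha> - 1) - ?\<delta> \<le> 2 * \<beta> / (2 * \<beta> - 1)"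
  proof (cases "k = 0")
    \<comment> \<open>The codomain may have \<open>n = 0\<close> here; the value of
      \<open>rate_loss\<close> at 0 makes the left side nonpositive.\<close>
    case True
    have "1 / (2 * \<alpha> - 1) \<le> 1 / (2 * \<epsilon>)" using \<alpha> assms by (auto intro!: frac_le)
    moreover have "2 * \<alpha> / (2 * \<alpha> - 1) = 1 + 1 / (2 * \<alpha> - 1)"
      using \<alpha> assms by (auto simp: divide_simps)
    moreover have "0 \<le> 2 * \<beta> / (2 * \<beta> - 1)" using \<beta> by simp
    ultimately show ?thesis using True by (simp add: rate_loss_def)
  next
    case False
    then have n: "n > 0" using hamming_map_codomain_pos[OF f] \<alpha> assms by simp
    \<comment> \<open>The whole space is a separated set, of size \<open>2 ^ k\<close>.\<close>
    have "(2 * \<alpha> / (2 * \<alpha> - 1) - ?\<delta>) * (2 * \<beta> - 1) * real (card (carrier_vec k :: bit vec set))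
        \<le> 2 ^ k * (2 * \<beta>)"
      by (rule separated_set_rate_bound[OF assms subset_refl _ n \<alpha> \<beta>, of f])
        (use f in \<open>force simp: hamming_map_def\<close>)+
    then have "(2 * \<alpha> / (2 * \<alpha> - 1) - ?\<delta>) * (2 * \<beta> - 1) \<le> 2 * \<beta>"
      by (simp add: card_carrier_bit_vec mult.commute)
    then show ?thesis using \<beta> by (simp add: pos_le_divide_eq)
  qed
  then have "2 * \<alpha> / (2 * \<alpha> - 1) - 2 * \<beta> / (2 * \<beta> - 1) \<le> ?\<delta>" by simp
  moreover have "2 * \<alpha> / (2 * \<alpha> - 1) - 2 * \<beta> / (2 * \<beta> - 1)
      = 2 * (\<beta> - \<alpha>) / ((2 * \<alpha> - 1) * (2 * \<beta> - 1))"
    using \<alpha> \<beta> assms by (simp add: divide_simps) (simp add: algebra_simps)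
  ultimately have gap: "2 * (\<beta> - \<alpha>) \<le> ?\<delta> * ((2 * \<alpha> - 1) * (2 * \<beta> - 1))"
    using \<alpha> \<beta> assms by (simp add: pos_divide_le_eq)
  \<comment> \<open>Only \<open>\<beta> > \<alpha>\<close> needs \<open>gap\<close>; then
    \<open>2 * \<alpha> - 1\<close> may be enlarged to \<open>2 * \<beta> - 1\<close>, which
    produces the square.\<close>
  show "\<alpha> \<ge> \<beta> - (2 * \<beta> - 1)\<^sup>2 / 2 * ?\<delta>"
  proof (cases "\<beta> \<le> \<alpha>")
    case True
    have "0 \<le> (2 * \<beta> - 1)\<^sup>2 / 2 * ?\<delta>" using \<delta> by simp
    then show ?thesis using True by linarith
  next
    case False
    then have "?\<delta> * ((2 * \<alpha> - 1) * (2 * \<beta> - 1)) \<le> ?\<delta> * ((2 * \<beta> - 1) * (2 * \<beta> - 1))"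
      using \<delta> \<beta> by (intro mult_left_mono mult_right_mono) auto
    then show ?thesis using gap by (simp add: power2_eq_square mult.commute)
  qed
next
  fix k n :: nat and f :: "bit vec \<Rightarrow> bit vec" and \<alpha> \<beta> :: real and S :: "bit vec set"
  let ?c = "2 * \<alpha> / (2 * \<alpha> - 1) - rate_loss \<epsilon> k"
  assume "k > 0" and n: "n > 0" and f: "f \<in> carrier_vec k \<rightarrow> carrier_vec n"
    and \<beta>: "\<beta> > 1/2" and \<alpha>: "\<alpha> \<in> {1/2 + \<epsilon>..1 - \<epsilon>}" and S: "S \<subseteq> carrier_vec k"
    and c: "?c > 0" and big: "real (card S) > 2 ^ k * ((2 * \<beta> / (2 * \<beta> - 1)) / ?c)"
  show "\<exists>x \<in> S. \<exists>x' \<in> S. real (hamming_weight (x - x')) > \<alpha> * real k \<and>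
    real (hamming_weight (f x - f x')) \<le> \<beta> * real n"
  proof (rule ccontr)
    assume neg: "\<not> ?thesis"
    \<comment> \<open>Without such a pair, \<open>S\<close> is separated, and the resulting bound
      contradicts \<open>big\<close>.\<close>
    have "?c * (2 * \<beta> - 1) * real (card S) \<le> 2 ^ k * (2 * \<beta>)"
      by (rule separated_set_rate_bound[OF assms S f n \<alpha> \<beta>]) (use neg in force)
    moreover have "2 ^ k * (2 * \<beta>) < ?c * (2 * \<beta> - 1) * real (card S)"
    proof -
      have "0 < ?c * (2 * \<beta> - 1)" using c \<beta> by simp
      then have "?c * (2 * \<beta> - 1) * (2 ^ k * ((2 * \<beta> / (2 * \<beta> - 1)) / ?c))
          < ?c * (2 * \<beta> - 1) * real (card S)"
        using big by (rule mult_strict_left_mono[rotated])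
      moreover have "b * d * (m * ((e / d) / b)) = m * e" if "b > 0" "d > 0" for b d m e :: real
        using that by simp
      ultimately show ?thesis using c \<beta> by simp
    qed
    ultimately show False by simp
  qed
qed

end
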